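(* Let $\mathfrak{g}$ be a finite dimensional reductive Lie algebra over $\mathbb{C}$ and let $A$ be a commutative $\mathbb{C}$-algebra with identity. Let $\theta\in[\mathfrak{g}^{\otimes k}]^{\mathfrak{g}}$ be any $\mathfrak{g}$-invariant and let $P_1,\dots,P_k\in A$. Then $[\mathfrak{g},\theta(P_1,\dots,P_k)]=0$ in $U(\mathfrak{g}\otimes A)$, i.e. $\theta(P_1,\dots,P_k)$ commutes with every element of $\mathfrak{g}$.
   Context: $\mathfrak{g}\otimes A$ is the Lie algebra with bracket $[x(P),y(Q)]=[x,y](PQ)$, where $x(P):=x\otimes P$ for $x\in\mathfrak{g}$, $P\in A$; $\mathfrak{g}$ is identified with $\mathfrak{g}\otimes 1$. $U(\mathfrak{g}\otimes A)$ is its universal enveloping algebra. $[\mathfrak{g}^{\otimes k}]^{\mathfrak{g}}$ denotes the invariants in $\mathfrak{g}^{\otimes k}$ under the (tensor product of the) adjoint action. For $\theta=\sum_i x_1^i\otimes\cdots\otimes x_k^i$ in $[\mathfrak{g}^{\otimes k}]^{\mathfrak{g}}$ and $P_1,\dots,P_k\in A$, $$\theta(P_1,\dots,P_k):=\sum_i x_1^i(P_1)\cdots x_k^i(P_k)\in U(\mathfrak{g}\otimes A).$$ *)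

theory Defs
  imports Complex_Main "HOL-Library.Poly_Mapping"
begin

class complex_vector = ab_group_add +
  fixes scaleC :: "complex \<Rightarrow> 'a \<Rightarrow> 'a"  (infixr \<open>*\<^sub>C\<close> 75)
  assumes scaleC_add_right: "a *\<^sub>C (x + y) = a *\<^sub>C x + a *\<^sub>C y"
    and scaleC_add_left: "(a + b) *\<^sub>C x = a *\<^sub>C x + b *\<^sub>C x"
    and scaleC_scaleC: "a *\<^sub>C (b *\<^sub>C x) = (a * b) *\<^sub>C x"
    and scaleC_one: "1 *\<^sub>C x = x"

global_interpretation complex_vector:
  vector_space "scaleC :: complex \<Rightarrow> 'a \<Rightarrow> 'a::complex_vector"
  by unfold_locales (rule scaleC_add_right scaleC_add_left scaleC_scaleC scaleC_one)+

definition finite_dimensional :: "'v::complex_vector itself \<Rightarrow> bool" where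
  "finite_dimensional _ \<longleftrightarrow> (\<exists>B :: 'v set. finite B \<and> complex_vector.span B = UNIV)"

text \<open>Unital associative algebras. The sort \<open>{ring, monoid_mult}\<close> is used instead of
  \<^class>\<open>ring_1\<close> because the latter excludes the zero algebra.\<close>

class complex_algebra_1 = complex_vector + ring + monoid_mult +
  assumes scaleC_mult_left: "(a *\<^sub>C x) * y = a *\<^sub>C (x * y)"
    and scaleC_mult_right: "x * (a *\<^sub>C y) = a *\<^sub>C (x * y)"

class complex_comm_algebra_1 = complex_algebra_1 + comm_ring + comm_monoid_mult

class complex_lie_algebra = complex_vector +
  fixes lie :: "'a \<Rightarrow> 'a \<Rightarrow> 'a"
  assumes lie_add_left: "lie (x + y) z = lie x z + lie y z"
    and lie_add_right: "lie x (y + z) = lie x y + lie x z"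
    and lie_scaleC_left: "lie (a *\<^sub>C x) y = a *\<^sub>C lie x y"
    and lie_scaleC_right: "lie x (a *\<^sub>C y) = a *\<^sub>C lie x y"
    and lie_self: "lie x x = 0"
    and lie_jacobi: "lie x (lie y z) + lie y (lie z x) + lie z (lie x y) = 0"

definition lie_ideal :: "'g::complex_lie_algebra set \<Rightarrow> bool" where
  "lie_ideal I \<longleftrightarrow> complex_vector.subspace I \<and> (\<forall>x. \<forall>y\<in>I. lie x y \<in> I)"

text \<open>Reductive means that the adjoint representation is semisimple (completely reducible):
  its subrepresentations are the ideals, and each of them has a complementary one.\<close>

definition reductive :: "'g::complex_lie_algebra itself \<Rightarrow> bool" where
  "reductive _ \<longleftrightarrow> (\<forall>I :: 'g set. lie_ideal I \<longrightarrow>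
     (\<exists>J. lie_ideal J \<and> I \<inter> J = {0} \<and> (\<forall>v. \<exists>a\<in>I. \<exists>b\<in>J. v = a + b)))"

lemma lie_antisym: "lie x y = - lie y (x :: 'g::complex_lie_algebra)"
proof -
  have "lie (x + y) (x + y) = lie x y + lie y x"
    by (subst lie_add_left) (simp add: lie_add_right lie_self)
  then have "lie x y + lie y x = 0"
    by (simp only: lie_self)
  then show ?thesis by (simp add: eq_neg_iff_add_eq_0)
qed

definition commutator :: "'u::ring \<Rightarrow> 'u \<Rightarrow> 'u" where
  "commutator u v = u * v - v * u"

definition ideal_gen :: "'u::complex_algebra_1 set \<Rightarrow> 'u set" where
  "ideal_gen R = complex_vector.span {a * r * b | a r b. r \<in> R}"

lemma ideal_gen_base: "r \<in> R \<Longrightarrow> r \<in> ideal_gen R"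
proof -
  assume "r \<in> R"
  then have "1 * r * 1 \<in> {a * r * b | a r b. r \<in> R}" by blast
  then show ?thesis by (simp add: ideal_gen_def complex_vector.span_base)
qed

lemma ideal_gen_subspace: "complex_vector.subspace (ideal_gen R)"
  by (simp add: ideal_gen_def)

lemma ideal_gen_mult:
  assumes "x \<in> ideal_gen R"
  shows "a * x \<in> ideal_gen R" and "x * a \<in> ideal_gen R"
proof -
  have "a * x \<in> ideal_gen R \<and> x * a \<in> ideal_gen R"
    using assms unfolding ideal_gen_def
  proof (induction rule: complex_vector.span_induct_alt)
    case base
    then show ?case by (simp add: complex_vector.span_zero)
  next
    case (step c x y)
    then obtain p r q where "x = p * r * q" "r \<in> R" by blast
    then have "a * x = (a * p) * r * q" "x * a = p * r * (q * a)"
      by (simp_all add: mult.assoc)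
    with \<open>r \<in> R\<close> have "a * x \<in> {a * r * b | a r b. r \<in> R}" "x * a \<in> {a * r * b | a r b. r \<in> R}"
      by blast+
    with step show ?case
      by (auto simp: distrib_left distrib_right scaleC_mult_left scaleC_mult_right
          intro!: complex_vector.span_add complex_vector.span_scale intro: complex_vector.span_base)
  qed
  then show "a * x \<in> ideal_gen R" "x * a \<in> ideal_gen R" by auto
qed

instantiation complex :: complex_comm_algebra_1
begin
definition "scaleC_complex = ((*) :: complex \<Rightarrow> complex \<Rightarrow> complex)"
instance by standard (simp_all add: scaleC_complex_def algebra_simps)
end

instantiation poly_mapping :: (type, complex_vector) complex_vector
begin
lift_definition scaleC_poly_mapping :: "complex \<Rightarrow> ('a \<Rightarrow>\<^sub>0 'b) \<Rightarrow> ('a \<Rightarrow>\<^sub>0 'b)"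
  is "\<lambda>c f x. c *\<^sub>C f x"
proof -
  fix c and f :: "'a \<Rightarrow> 'b"
  assume "finite {x. f x \<noteq> 0}"
  then show "finite {x. c *\<^sub>C f x \<noteq> 0}"
    by (rule finite_subset[rotated]) auto
qed
instance
  by standard (transfer, simp add: fun_eq_iff scaleC_add_right scaleC_add_left)+
end

lemma lookup_scaleC: "Poly_Mapping.lookup (c *\<^sub>C f) x = c *\<^sub>C Poly_Mapping.lookup f x"
  by transfer simp

lemma scaleC_single: "c *\<^sub>C Poly_Mapping.single x b = Poly_Mapping.single x (c *\<^sub>C b)"
  by (rule poly_mapping_eqI) (simp add: lookup_scaleC lookup_single when_def)

lemma poly_mapping_single_induct [case_names single add]:
  assumes "\<And>x c. P (Poly_Mapping.single x c)" and "\<And>f g. P f \<Longrightarrow> P g \<Longrightarrow> P (f + g)"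
  shows "P (f :: 'x \<Rightarrow>\<^sub>0 'c::monoid_add)"
proof (induction f rule: update_induct)
  case const
  then show ?case using assms(1)[of undefined 0] by simp
next
  case (update f a b)
  have "Poly_Mapping.update a b f = f + Poly_Mapping.single a b"
    using update.hyps
    by (intro poly_mapping_eqI) (auto simp: lookup_update lookup_add lookup_single when_def in_keys_iff)
  then show ?case using update assms by metis
qed

instance poly_mapping :: (monoid_add, "{complex_algebra_1, ring_1}") complex_algebra_1
proof
  fix a and f g :: "'a \<Rightarrow>\<^sub>0 'b"
  have *: "(a *\<^sub>C Poly_Mapping.single x c) * g = a *\<^sub>C (Poly_Mapping.single x c * g)" for x c
    by (induction g rule: poly_mapping_single_induct)
      (simp_all add: scaleC_single mult_single scaleC_mult_left distrib_left scaleC_add_right)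
  show "a *\<^sub>C f * g = a *\<^sub>C (f * g)"
    by (induction f rule: poly_mapping_single_induct)
      (simp_all add: * distrib_right scaleC_add_right)
  have *: "Poly_Mapping.single x c * (a *\<^sub>C g) = a *\<^sub>C (Poly_Mapping.single x c * g)" for x c
    by (induction g rule: poly_mapping_single_induct)
      (simp_all add: scaleC_single mult_single scaleC_mult_right distrib_left scaleC_add_right)
  show "f * (a *\<^sub>C g) = a *\<^sub>C (f * g)"
    by (induction f rule: poly_mapping_single_induct)
      (simp_all add: * distrib_right scaleC_add_right)
qed

text \<open>Words form a monoid under concatenation (written additively, since the index monoid of
  \<^type>\<open>poly_mapping\<close> is additive); so \<open>'x list \<Rightarrow>\<^sub>0 complex\<close> is the free unital associative
  algebra on the set \<open>'x\<close>.\<close>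

instantiation list :: (type) monoid_add
begin
definition "zero_list = ([] :: 'a list)"
definition "plus_list = ((@) :: 'a list \<Rightarrow> 'a list \<Rightarrow> 'a list)"
instance by standard (simp_all add: zero_list_def plus_list_def)
end

abbreviation basis_vec :: "'x \<Rightarrow> 'x \<Rightarrow>\<^sub>0 complex" where
  "basis_vec x \<equiv> Poly_Mapping.single x 1"

lemma basis_vec_mult: "basis_vec u * basis_vec v = basis_vec (u @ v)"
  by (simp add: mult_single plus_list_def)

lemma basis_vec_Nil: "basis_vec [] = 1"
  using single_one by (metis zero_list_def)

lemma basis_vec_induct [case_names basis scale add]:
  assumes "\<And>x. P (basis_vec x)" and "\<And>c f. P f \<Longrightarrow> P (c *\<^sub>C f)" and "\<And>f g. P f \<Longrightarrow> P g \<Longrightarrow> P (f + g)"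
  shows "P f"
proof (induction f rule: poly_mapping_single_induct)
  case (single x c)
  have "Poly_Mapping.single x c = c *\<^sub>C basis_vec x"
    by (simp add: scaleC_single scaleC_complex_def)
  then show ?case using assms by metis
qed (rule assms)

definition lin_ext :: "('x \<Rightarrow> 'v::complex_vector) \<Rightarrow> ('x \<Rightarrow>\<^sub>0 complex) \<Rightarrow> 'v" where
  "lin_ext f p = (\<Sum>x\<in>Poly_Mapping.keys p. Poly_Mapping.lookup p x *\<^sub>C f x)"

lemma lin_ext_superset:
  assumes "finite A" "Poly_Mapping.keys p \<subseteq> A"
  shows "lin_ext f p = (\<Sum>x\<in>A. Poly_Mapping.lookup p x *\<^sub>C f x)"
  unfolding lin_ext_def by (rule sum.mono_neutral_left) (use assms in \<open>auto simp: in_keys_iff\<close>)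

lemma lin_ext_basis [simp]: "lin_ext f (basis_vec x) = f x"
  by (simp add: lin_ext_def scaleC_one)

lemma lin_ext_zero [simp]: "lin_ext f 0 = 0"
  by (simp add: lin_ext_def)

lemma lin_ext_add: "lin_ext f (p + q) = lin_ext f p + lin_ext f q"
proof -
  let ?A = "Poly_Mapping.keys p \<union> Poly_Mapping.keys q"
  have "Poly_Mapping.keys (p + q) \<subseteq> ?A" by (rule keys_add)
  then show ?thesis
    by (simp add: lin_ext_superset[of ?A] lookup_add scaleC_add_left sum.distrib)
qed

lemma lin_ext_scale: "lin_ext f (c *\<^sub>C p) = c *\<^sub>C lin_ext f p"
proof -
  have "Poly_Mapping.keys (c *\<^sub>C p) \<subseteq> Poly_Mapping.keys p"
    by (auto simp: in_keys_iff lookup_scaleC)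
  then show ?thesis
    by (simp add: lin_ext_superset[of "Poly_Mapping.keys p"] lookup_scaleC
        complex_vector.scale_sum_right scaleC_complex_def)
qed

lemma lin_ext_diff: "lin_ext f (p - q) = lin_ext f p - lin_ext f q"
  using lin_ext_add[of f "p - q" q] by simp

lemma lin_ext_fun_add: "lin_ext (\<lambda>x. f x + g x) p = lin_ext f p + lin_ext g p"
  by (simp add: lin_ext_def scaleC_add_right sum.distrib)

lemma lin_ext_fun_scale: "lin_ext (\<lambda>x. c *\<^sub>C f x) p = c *\<^sub>C lin_ext f p"
  by (simp add: lin_ext_def complex_vector.scale_sum_right mult.commute)

definition bilinear_rels :: "('v::complex_vector \<times> 'w::complex_vector \<Rightarrow>\<^sub>0 complex) set" where
  "bilinear_rels =
     {basis_vec (x + y, w) - basis_vec (x, w) - basis_vec (y, w) | x y w. True} \<union>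
     {basis_vec (x, w + z) - basis_vec (x, w) - basis_vec (x, z) | x w z. True} \<union>
     {basis_vec (c *\<^sub>C x, w) - c *\<^sub>C basis_vec (x, w) | c x w. True} \<union>
     {basis_vec (x, c *\<^sub>C w) - c *\<^sub>C basis_vec (x, w) | c x w. True}"

lemma equivp_mod_subspace:
  assumes "complex_vector.subspace S"
  shows "equivp (\<lambda>p q. p - q \<in> S)"
proof (intro equivpI reflpI sympI transpI)
  fix p q r
  show "p - p \<in> S" using assms by (simp add: complex_vector.subspace_0)
  show "q - p \<in> S" if "p - q \<in> S"
    using complex_vector.subspace_neg[OF assms that] by simp
  show "p - r \<in> S" if "p - q \<in> S" "q - r \<in> S"
    using complex_vector.subspace_add[OF assms that] by simp
qed

quotient_type (overloaded) ('v, 'w) tensor =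
  "('v::complex_vector \<times> 'w::complex_vector) \<Rightarrow>\<^sub>0 complex" /
  "\<lambda>p q. p - q \<in> complex_vector.span bilinear_rels"
  by (rule equivp_mod_subspace) simp

lemma mod_subspace_arith:
  assumes "complex_vector.subspace S"
  shows "p - p' \<in> S \<Longrightarrow> q - q' \<in> S \<Longrightarrow> (p + q) - (p' + q') \<in> S"
    and "p - p' \<in> S \<Longrightarrow> q - q' \<in> S \<Longrightarrow> (p - q) - (p' - q') \<in> S"
    and "p - p' \<in> S \<Longrightarrow> (- p) - (- p') \<in> S"
    and "p - p' \<in> S \<Longrightarrow> (c *\<^sub>C p) - (c *\<^sub>C p') \<in> S"
    and "p = p' \<Longrightarrow> p - p' \<in> S"
  using complex_vector.subspace_add[OF assms, of "p - p'" "q - q'"]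
    complex_vector.subspace_diff[OF assms, of "p - p'" "q - q'"]
    complex_vector.subspace_neg[OF assms, of "p - p'"]
    complex_vector.subspace_scale[OF assms, of "p - p'" c]
    complex_vector.subspace_0[OF assms]
  by (simp_all add: algebra_simps complex_vector.scale_right_diff_distrib)

lemmas tensor_arith = mod_subspace_arith[OF complex_vector.subspace_span, where S1 = bilinear_rels]

instantiation tensor :: (complex_vector, complex_vector) complex_vector
begin
lift_definition zero_tensor :: "('a, 'b) tensor" is 0 .
lift_definition plus_tensor :: "('a, 'b) tensor \<Rightarrow> ('a, 'b) tensor \<Rightarrow> ('a, 'b) tensor" is "(+)"
  by (rule tensor_arith)
lift_definition minus_tensor :: "('a, 'b) tensor \<Rightarrow> ('a, 'b) tensor \<Rightarrow> ('a, 'b) tensor" is "(-)"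
  by (rule tensor_arith)
lift_definition uminus_tensor :: "('a, 'b) tensor \<Rightarrow> ('a, 'b) tensor" is uminus
  by (rule tensor_arith)
lift_definition scaleC_tensor :: "complex \<Rightarrow> ('a, 'b) tensor \<Rightarrow> ('a, 'b) tensor" is scaleC
  by (rule tensor_arith)
instance
  by standard (transfer, rule tensor_arith, simp add: scaleC_add_right scaleC_add_left ac_simps)+
end

lift_definition tensor_pure :: "'v::complex_vector \<Rightarrow> 'w::complex_vector \<Rightarrow> ('v, 'w) tensor"
  (infixr \<open>\<otimes>\<close> 70) is "\<lambda>x w. basis_vec (x, w)" .

lemma bilinear_rels_cases:
  assumes "r \<in> bilinear_rels"
  obtains x y w where "r = basis_vec (x + y, w) - basis_vec (x, w) - basis_vec (y, w)"
  | x w z where "r = basis_vec (x, w + z) - basis_vec (x, w) - basis_vec (x, z)"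
  | c x w where "r = basis_vec (c *\<^sub>C x, w) - c *\<^sub>C basis_vec (x, w)"
  | c x w where "r = basis_vec (x, c *\<^sub>C w) - c *\<^sub>C basis_vec (x, w)"
  using assms unfolding bilinear_rels_def by blast

lemma bilinear_rels_in_span:
  "basis_vec (x + y, w) - basis_vec (x, w) - basis_vec (y, w) \<in> complex_vector.span bilinear_rels"
  "basis_vec (x, w + z) - basis_vec (x, w) - basis_vec (x, z) \<in> complex_vector.span bilinear_rels"
  "basis_vec (c *\<^sub>C x, w) - c *\<^sub>C basis_vec (x, w) \<in> complex_vector.span bilinear_rels"
  "basis_vec (x, c *\<^sub>C w) - c *\<^sub>C basis_vec (x, w) \<in> complex_vector.span bilinear_rels"
  unfolding bilinear_rels_def by (rule complex_vector.span_base, blast)+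

lemma tensor_pure_linear:
  "(x + y) \<otimes> w = x \<otimes> w + y \<otimes> w"
  "x \<otimes> (w + z) = x \<otimes> w + x \<otimes> z"
  "(c *\<^sub>C x) \<otimes> w = c *\<^sub>C (x \<otimes> w)"
  "x \<otimes> (c *\<^sub>C w) = c *\<^sub>C (x \<otimes> w)"
  by (transfer, simp add: bilinear_rels_in_span flip: diff_diff_add)+

lemma tensor_induct [case_names pure add]:
  assumes "\<And>x w. P (x \<otimes> w)" and "\<And>u v. P u \<Longrightarrow> P v \<Longrightarrow> P (u + v)"
  shows "P u"
proof -
  have "P (abs_tensor p)" for p
  proof (induction p rule: poly_mapping_single_induct)
    case (single y c)
    obtain x w where "y = (x, w)" by force
    then have "Poly_Mapping.single y c = c *\<^sub>C basis_vec (x, w)"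
      by (simp add: scaleC_single scaleC_complex_def)
    then have "abs_tensor (Poly_Mapping.single y c) = (c *\<^sub>C x) \<otimes> w"
      by (simp only: tensor_pure_linear) (simp add: tensor_pure.abs_eq scaleC_tensor.abs_eq)
    then show ?case using assms by simp
  next
    case (add f g)
    then show ?case using assms by (simp flip: plus_tensor.abs_eq)
  qed
  then show ?thesis by (induction u rule: tensor.abs_induct)
qed

definition pre_bracket ::
  "('g::complex_lie_algebra \<times> 'a::complex_comm_algebra_1 \<Rightarrow>\<^sub>0 complex) \<Rightarrow>
   ('g \<times> 'a \<Rightarrow>\<^sub>0 complex) \<Rightarrow> ('g \<times> 'a \<Rightarrow>\<^sub>0 complex)" where
  "pre_bracket p q =
     lin_ext (\<lambda>(x, P). lin_ext (\<lambda>(y, Q). basis_vec (lie x y, P * Q)) q) p"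

lemma pre_bracket_bilinear:
  "pre_bracket (p + p') q = pre_bracket p q + pre_bracket p' q"
  "pre_bracket (p - p') q = pre_bracket p q - pre_bracket p' q"
  "pre_bracket (c *\<^sub>C p) q = c *\<^sub>C pre_bracket p q"
  "pre_bracket p (q + q') = pre_bracket p q + pre_bracket p q'"
  "pre_bracket p (c *\<^sub>C q) = c *\<^sub>C pre_bracket p q"
  by (simp_all add: pre_bracket_def lin_ext_add lin_ext_diff lin_ext_scale split_def
      flip: lin_ext_fun_add lin_ext_fun_scale)

lemma pre_bracket_diff_right: "pre_bracket p (q - q') = pre_bracket p q - pre_bracket p q'"
  using pre_bracket_bilinear(4)[of p "q - q'" q'] by simp

lemma pre_bracket_basis [simp]:
  "pre_bracket (basis_vec (x, P)) (basis_vec (y, Q)) = basis_vec (lie x y, P * Q)"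
  by (simp add: pre_bracket_def)

lemma pre_bracket_zero [simp]: "pre_bracket 0 q = 0" "pre_bracket p 0 = 0"
  using pre_bracket_bilinear(3)[of 0 0 q] pre_bracket_bilinear(5)[of p 0 0] by simp_all

lemma pre_bracket_span_left:
  assumes "p \<in> complex_vector.span bilinear_rels"
  shows "pre_bracket p q \<in> complex_vector.span bilinear_rels"
  using assms
proof (induction rule: complex_vector.span_induct_alt)
  case base
  then show ?case by (simp add: complex_vector.span_zero)
next
  case (step c r p)
  have "pre_bracket r q \<in> complex_vector.span bilinear_rels"
  proof (induction q rule: basis_vec_induct)
    case (basis z)
    obtain y Q where "z = (y, Q)" by force
    with step.hyps show ?case
      by (auto elim!: bilinear_rels_cases simp: pre_bracket_bilinear lie_add_left lie_scaleC_left
          distrib_right scaleC_mult_left bilinear_rels_in_span)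
  qed (auto simp: pre_bracket_bilinear intro: complex_vector.span_add complex_vector.span_scale)
  with step show ?case
    by (auto simp: pre_bracket_bilinear intro: complex_vector.span_add complex_vector.span_scale)
qed

lemma pre_bracket_span_right:
  assumes "q \<in> complex_vector.span bilinear_rels"
  shows "pre_bracket p q \<in> complex_vector.span bilinear_rels"
  using assms
proof (induction rule: complex_vector.span_induct_alt)
  case base
  then show ?case by (simp add: complex_vector.span_zero)
next
  case (step c r q)
  have "pre_bracket p r \<in> complex_vector.span bilinear_rels"
  proof (induction p rule: basis_vec_induct)
    case (basis z)
    obtain y Q where "z = (y, Q)" by force
    with step.hyps show ?case
      by (auto elim!: bilinear_rels_cases simp: pre_bracket_bilinear pre_bracket_diff_right
          lie_add_right lie_scaleC_right distrib_left scaleC_mult_right bilinear_rels_in_span)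
  qed (auto simp: pre_bracket_bilinear intro: complex_vector.span_add complex_vector.span_scale)
  with step show ?case
    by (auto simp: pre_bracket_bilinear intro: complex_vector.span_add complex_vector.span_scale)
qed

instantiation tensor :: (complex_lie_algebra, complex_comm_algebra_1) complex_lie_algebra
begin

lift_definition lie_tensor :: "('a, 'b) tensor \<Rightarrow> ('a, 'b) tensor \<Rightarrow> ('a, 'b) tensor"
  is pre_bracket
proof -
  fix p p' q q' :: "'a \<times> 'b \<Rightarrow>\<^sub>0 complex"
  assume "p - p' \<in> complex_vector.span bilinear_rels" "q - q' \<in> complex_vector.span bilinear_rels"
  then have "pre_bracket (p - p') q + pre_bracket p' (q - q') \<in> complex_vector.span bilinear_rels"
    by (intro complex_vector.span_add pre_bracket_span_left pre_bracket_span_right)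
  then show "pre_bracket p q - pre_bracket p' q' \<in> complex_vector.span bilinear_rels"
    by (simp add: pre_bracket_bilinear pre_bracket_diff_right)
qed

lemma lie_tensor_pure: "lie (x \<otimes> P) (y \<otimes> Q) = lie x y \<otimes> (P * Q)"
  for x :: 'a and P :: 'b
  by transfer (simp add: complex_vector.span_zero)

instance
proof
  fix u v w :: "('a, 'b) tensor" and c
  show add_l: "lie (u + v) w = lie u w + lie v w" for u v w :: "('a, 'b) tensor"
    by transfer (rule tensor_arith, rule pre_bracket_bilinear)
  show add_r: "lie u (v + w) = lie u v + lie u w" for u v w :: "('a, 'b) tensor"
    by transfer (rule tensor_arith, rule pre_bracket_bilinear)
  show "lie (c *\<^sub>C u) v = c *\<^sub>C lie u v"
    by transfer (rule tensor_arith, rule pre_bracket_bilinear)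
  show "lie u (c *\<^sub>C v) = c *\<^sub>C lie u v"
    by transfer (rule tensor_arith, rule pre_bracket_bilinear)
  have neg: "(- x) \<otimes> P = - (x \<otimes> P)" for x :: 'a and P :: 'b
    using tensor_pure_linear(3)[of "-1" x P] by simp
  have zero: "0 \<otimes> P = (0 :: ('a, 'b) tensor)" for P
    using tensor_pure_linear(3)[of 0 0 P] by simp
  have anti: "lie u v = - lie v u" for u v :: "('a, 'b) tensor"
  proof (induction u rule: tensor_induct)
    case (pure x P)
    show ?case
    proof (induction v rule: tensor_induct)
      case (pure y Q)
      show ?case
        using lie_antisym[of x y] by (simp add: lie_tensor_pure mult.commute neg)
    qed (simp add: add_l add_r)
  qed (simp add: add_l add_r)
  have "lie u u + lie u u = 0"
    using anti[of u u] by (metis add.right_inverse)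
  then have "(2 :: complex) *\<^sub>C lie u u = 0"
    using scaleC_add_left[of 1 1 "lie u u"] by (simp add: scaleC_one)
  then show "lie u u = 0" by simp
  show "lie u (lie v w) + lie v (lie w u) + lie w (lie u v) = 0"
  proof (induction u rule: tensor_induct)
    case (pure x P)
    show ?case
    proof (induction v rule: tensor_induct)
      case (pure y Q)
      show ?case
      proof (induction w rule: tensor_induct)
        case (pure z R)
        have "P * (Q * R) = Q * (R * P)" "R * (P * Q) = Q * (R * P)"
          by (simp_all add: ac_simps)
        then show ?case
          by (simp add: lie_tensor_pure lie_jacobi zero flip: tensor_pure_linear(1))
      next
        case (add w w')
        have "lie (x \<otimes> P) (lie (y \<otimes> Q) (w + w')) + lie (y \<otimes> Q) (lie (w + w') (x \<otimes> P))
              + lie (w + w') (lie (x \<otimes> P) (y \<otimes> Q))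
            = (lie (x \<otimes> P) (lie (y \<otimes> Q) w) + lie (y \<otimes> Q) (lie w (x \<otimes> P))
              + lie w (lie (x \<otimes> P) (y \<otimes> Q)))
            + (lie (x \<otimes> P) (lie (y \<otimes> Q) w') + lie (y \<otimes> Q) (lie w' (x \<otimes> P))
              + lie w' (lie (x \<otimes> P) (y \<otimes> Q)))"
          by (simp only: add_l add_r ac_simps)
        with add show ?case by simp
      qed
    next
      case (add v v')
      have "lie (x \<otimes> P) (lie (v + v') w) + lie (v + v') (lie w (x \<otimes> P))
            + lie w (lie (x \<otimes> P) (v + v'))
          = (lie (x \<otimes> P) (lie v w) + lie v (lie w (x \<otimes> P)) + lie w (lie (x \<otimes> P) v))
          + (lie (x \<otimes> P) (lie v' w) + lie v' (lie w (x \<otimes> P)) + lie w (lie (x \<otimes> P) v'))"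
        by (simp only: add_l add_r ac_simps)
      with add show ?case by simp
    qed
  next
    case (add u u')
    have "lie (u + u') (lie v w) + lie v (lie w (u + u')) + lie w (lie (u + u') v)
        = (lie u (lie v w) + lie v (lie w u) + lie w (lie u v))
        + (lie u' (lie v w) + lie v (lie w u') + lie w (lie u' v))"
      by (simp only: add_l add_r ac_simps)
    with add show ?case by simp
  qed
qed

end

definition linear_rels :: "('v::complex_vector list \<Rightarrow>\<^sub>0 complex) set" where
  "linear_rels = {basis_vec [x + y] - basis_vec [x] - basis_vec [y] | x y. True} \<union>
     {basis_vec [c *\<^sub>C x] - c *\<^sub>C basis_vec [x] | c x. True}"

quotient_type (overloaded) 'v tensor_algebra = "'v::complex_vector list \<Rightarrow>\<^sub>0 complex" /
  "\<lambda>p q. p - q \<in> ideal_gen linear_rels"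
  by (rule equivp_mod_subspace) (rule ideal_gen_subspace)

lemma mod_ideal_mult:
  assumes "p - p' \<in> ideal_gen R" "q - q' \<in> ideal_gen R"
  shows "p * q - p' * q' \<in> ideal_gen R"
proof -
  have "(p - p') * q + p' * (q - q') \<in> ideal_gen R"
    by (intro complex_vector.subspace_add[OF ideal_gen_subspace] ideal_gen_mult assms)
  then show ?thesis by (simp add: algebra_simps)
qed

lemmas ideal_arith = mod_subspace_arith[OF ideal_gen_subspace]

instantiation tensor_algebra :: (complex_vector) complex_algebra_1
begin
lift_definition zero_tensor_algebra :: "'a tensor_algebra" is 0 .
lift_definition one_tensor_algebra :: "'a tensor_algebra" is 1 .
lift_definition plus_tensor_algebra :: "'a tensor_algebra \<Rightarrow> 'a tensor_algebra \<Rightarrow> 'a tensor_algebra"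
  is "(+)" by (rule ideal_arith)
lift_definition minus_tensor_algebra :: "'a tensor_algebra \<Rightarrow> 'a tensor_algebra \<Rightarrow> 'a tensor_algebra"
  is "(-)" by (rule ideal_arith)
lift_definition uminus_tensor_algebra :: "'a tensor_algebra \<Rightarrow> 'a tensor_algebra"
  is uminus by (rule ideal_arith)
lift_definition scaleC_tensor_algebra :: "complex \<Rightarrow> 'a tensor_algebra \<Rightarrow> 'a tensor_algebra"
  is scaleC by (rule ideal_arith)
lift_definition times_tensor_algebra :: "'a tensor_algebra \<Rightarrow> 'a tensor_algebra \<Rightarrow> 'a tensor_algebra"
  is "(*)" by (rule mod_ideal_mult)
instance
  by standard (transfer, rule ideal_arith,
      simp add: scaleC_add_right scaleC_add_left algebra_simps scaleC_mult_left scaleC_mult_right)+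
end

lift_definition tensor_inj :: "'v::complex_vector \<Rightarrow> 'v tensor_algebra" is "\<lambda>x. basis_vec [x]" .

lemma linear_rels_mem:
  "basis_vec [x + y] - basis_vec [x] - basis_vec [y] \<in> linear_rels"
  "basis_vec [c *\<^sub>C x] - c *\<^sub>C basis_vec [x] \<in> linear_rels"
  unfolding linear_rels_def by blast+

lemma linear_rels_cases:
  assumes "r \<in> linear_rels"
  obtains x y where "r = basis_vec [x + y] - basis_vec [x] - basis_vec [y]"
  | c x where "r = basis_vec [c *\<^sub>C x] - c *\<^sub>C basis_vec [x]"
  using assms unfolding linear_rels_def by blast

lemma tensor_inj_linear:
  "tensor_inj (x + y) = tensor_inj x + tensor_inj y"
  "tensor_inj (c *\<^sub>C x) = c *\<^sub>C tensor_inj x"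
  by (transfer, simp add: ideal_gen_base linear_rels_mem flip: diff_diff_add)+

text \<open>The \<open>k\<close>-th tensor power is the degree \<open>k\<close> component of the tensor algebra;
  \<open>pure_tensor [y1, ..., yk]\<close> is \<open>y1 \<otimes> ... \<otimes> yk\<close>.\<close>

definition pure_tensor :: "'v::complex_vector list \<Rightarrow> 'v tensor_algebra" where
  "pure_tensor ys = prod_list (map tensor_inj ys)"

definition tensor_power :: "nat \<Rightarrow> 'v::complex_vector tensor_algebra set" where
  "tensor_power k = complex_vector.span {pure_tensor ys | ys. length ys = k}"

lemma pure_tensor_abs: "pure_tensor ys = abs_tensor_algebra (basis_vec ys)"
  by (induction ys)
    (simp_all add: pure_tensor_def one_tensor_algebra.abs_eq tensor_inj.abs_eq
      times_tensor_algebra.abs_eq basis_vec_Nil basis_vec_mult)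

definition word_action :: "'g::complex_lie_algebra \<Rightarrow> 'g list \<Rightarrow> 'g list \<Rightarrow>\<^sub>0 complex" where
  "word_action x ys = (\<Sum>i<length ys. basis_vec (ys[i := lie x (ys ! i)]))"

lemma word_action_Nil [simp]: "word_action x [] = 0"
  by (simp add: word_action_def)

lemma word_action_Cons:
  "word_action x (y # ys) = basis_vec [lie x y] * basis_vec ys + basis_vec [y] * word_action x ys"
  by (simp add: word_action_def sum.lessThan_Suc_shift basis_vec_mult sum_distrib_left
      del: sum.lessThan_Suc)

lemma word_action_append:
  "word_action x (ys @ zs) = word_action x ys * basis_vec zs + basis_vec ys * word_action x zs"
proof (induction ys)
  case Nil
  then show ?case by (simp add: basis_vec_Nil)
next
  case (Cons y ys)
  have "basis_vec (y # ys) = basis_vec [y] * basis_vec ys"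
    by (simp add: basis_vec_mult)
  with Cons show ?case
    by (simp add: word_action_Cons distrib_left distrib_right mult.assoc flip: basis_vec_mult)
qed

lemma lin_ext_word_action_mult:
  "lin_ext (word_action x) (p * q) = lin_ext (word_action x) p * q + p * lin_ext (word_action x) q"
proof (induction p rule: basis_vec_induct)
  case (basis u)
  show ?case
    by (induction q rule: basis_vec_induct)
      (simp_all add: basis_vec_mult word_action_append distrib_left lin_ext_add lin_ext_scale
        scaleC_add_right scaleC_mult_right)
qed (simp_all add: distrib_right distrib_left lin_ext_add lin_ext_scale scaleC_add_right
    scaleC_mult_left)

lemma lin_ext_word_action_ideal:
  assumes "p \<in> ideal_gen linear_rels"
  shows "lin_ext (word_action x) p \<in> ideal_gen linear_rels"
  using assms unfolding ideal_gen_def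
proof (induction rule: complex_vector.span_induct_alt)
  case base
  then show ?case by (simp add: complex_vector.span_zero)
next
  case (step c s p)
  then obtain a r b where s: "s = a * r * b" and r: "r \<in> linear_rels" by blast
  have "lin_ext (word_action x) r \<in> linear_rels"
    using r by (auto elim!: linear_rels_cases simp: lin_ext_diff lin_ext_scale word_action_Cons
        basis_vec_Nil lie_add_right lie_scaleC_right linear_rels_mem)
  with r have "lin_ext (word_action x) s \<in> ideal_gen linear_rels"
    by (simp add: s lin_ext_word_action_mult ideal_gen_mult ideal_gen_base
        complex_vector.subspace_add[OF ideal_gen_subspace])
  with step.IH show ?case
    by (auto simp: lin_ext_add lin_ext_scale ideal_gen_def
        intro!: complex_vector.span_add complex_vector.span_scale)
qed

lift_definition adjoint_action ::
  "'g::complex_lie_algebra \<Rightarrow> 'g tensor_algebra \<Rightarrow> 'g tensor_algebra"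
  is "\<lambda>x. lin_ext (word_action x)"
  by (metis lin_ext_diff lin_ext_word_action_ideal)

lemma adjoint_action_linear:
  "adjoint_action x (s + t) = adjoint_action x s + adjoint_action x t"
  "adjoint_action x (c *\<^sub>C t) = c *\<^sub>C adjoint_action x t"
  by (transfer, rule ideal_arith, rule lin_ext_add lin_ext_scale)+

lemma adjoint_action_pure:
  "adjoint_action x (pure_tensor ys) = (\<Sum>i<length ys. pure_tensor (ys[i := lie x (ys ! i)]))"
proof -
  have "abs_tensor_algebra (\<Sum>i\<in>I. f i) = (\<Sum>i\<in>I. abs_tensor_algebra (f i))"
    if "finite I" for I and f :: "nat \<Rightarrow> 'a list \<Rightarrow>\<^sub>0 complex"
    using that
    by induction (simp_all add: zero_tensor_algebra.abs_eq flip: plus_tensor_algebra.abs_eq)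
  then show ?thesis
    by (simp add: pure_tensor_abs adjoint_action.abs_eq word_action_def)
qed

definition invariants :: "nat \<Rightarrow> 'g::complex_lie_algebra tensor_algebra set" where
  "invariants k = {\<theta> \<in> tensor_power k. \<forall>x. adjoint_action x \<theta> = 0}"

definition lie_rels :: "'l::complex_lie_algebra tensor_algebra set" where
  "lie_rels = {commutator (tensor_inj x) (tensor_inj y) - tensor_inj (lie x y) | x y. True}"

quotient_type (overloaded) 'l uea = "'l::complex_lie_algebra tensor_algebra" /
  "\<lambda>p q. p - q \<in> ideal_gen lie_rels"
  by (rule equivp_mod_subspace) (rule ideal_gen_subspace)

instantiation uea :: (complex_lie_algebra) complex_algebra_1
begin
lift_definition zero_uea :: "'a uea" is 0 .
lift_definition one_uea :: "'a uea" is 1 .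
lift_definition plus_uea :: "'a uea \<Rightarrow> 'a uea \<Rightarrow> 'a uea" is "(+)" by (rule ideal_arith)
lift_definition minus_uea :: "'a uea \<Rightarrow> 'a uea \<Rightarrow> 'a uea" is "(-)" by (rule ideal_arith)
lift_definition uminus_uea :: "'a uea \<Rightarrow> 'a uea" is uminus by (rule ideal_arith)
lift_definition scaleC_uea :: "complex \<Rightarrow> 'a uea \<Rightarrow> 'a uea" is scaleC by (rule ideal_arith)
lift_definition times_uea :: "'a uea \<Rightarrow> 'a uea \<Rightarrow> 'a uea" is "(*)" by (rule mod_ideal_mult)
instance
  by standard (transfer, rule ideal_arith,
      simp add: scaleC_add_right scaleC_add_left algebra_simps scaleC_mult_left scaleC_mult_right)+
end

lift_definition uea_inj :: "'l::complex_lie_algebra \<Rightarrow> 'l uea" is tensor_inj .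

lemma uea_inj_linear:
  "uea_inj (x + y) = uea_inj x + uea_inj y"
  "uea_inj (c *\<^sub>C x) = c *\<^sub>C uea_inj x"
  by (transfer, rule ideal_arith, rule tensor_inj_linear)+

lemma uea_inj_lie: "uea_inj (lie x y) = commutator (uea_inj x) (uea_inj y)"
proof -
  have "commutator (uea_inj x) (uea_inj y) = uea_inj (lie x y)"
    unfolding commutator_def
    by (transfer, rule ideal_gen_base) (auto simp: lie_rels_def commutator_def)
  then show ?thesis ..
qed

definition word_eval ::
  "'a::complex_comm_algebra_1 list \<Rightarrow> 'g::complex_lie_algebra list \<Rightarrow> ('g, 'a) tensor uea" where
  "word_eval Ps ys = (if length ys = length Ps
     then prod_list (map2 (\<lambda>y P. uea_inj (y \<otimes> P)) ys Ps) else 0)"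

lemma word_eval_linear:
  "word_eval Ps (us @ (x + y) # vs) = word_eval Ps (us @ x # vs) + word_eval Ps (us @ y # vs)"
  "word_eval Ps (us @ (c *\<^sub>C x) # vs) = c *\<^sub>C word_eval Ps (us @ x # vs)"
proof -
  have "word_eval Ps (us @ (x + y) # vs) = word_eval Ps (us @ x # vs) + word_eval Ps (us @ y # vs) \<and>
    word_eval Ps (us @ (c *\<^sub>C x) # vs) = c *\<^sub>C word_eval Ps (us @ x # vs)"
  proof (cases "length Ps = length (us @ x # vs)")
    case True
    define P1 P2 where "P1 = take (length us) Ps" and "P2 = drop (length us) Ps"
    have "Ps = P1 @ P2" "length us = length P1" "P2 \<noteq> []"
      using True by (auto simp: P1_def P2_def)
    then obtain P P3 where "Ps = P1 @ P # P3" "length us = length P1"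
      by (metis neq_Nil_conv)
    then show ?thesis
      by (simp add: word_eval_def tensor_pure_linear uea_inj_linear distrib_left distrib_right
          scaleC_mult_left scaleC_mult_right)
  qed (simp add: word_eval_def)
  then show "word_eval Ps (us @ (x + y) # vs)
      = word_eval Ps (us @ x # vs) + word_eval Ps (us @ y # vs)"
    "word_eval Ps (us @ (c *\<^sub>C x) # vs) = c *\<^sub>C word_eval Ps (us @ x # vs)"
    by auto
qed

lemma lin_ext_word_eval_ideal:
  assumes "p \<in> ideal_gen linear_rels"
  shows "lin_ext (word_eval Ps) p = 0"
  using assms unfolding ideal_gen_def
proof (induction rule: complex_vector.span_induct_alt)
  case (step c s p)
  then obtain a r b where s: "s = a * r * b" and r: "r \<in> linear_rels" by blast
  have "lin_ext (word_eval Ps) (a * r * b) = 0"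
  proof (induction a rule: basis_vec_induct)
    case (basis us)
    show ?case
    proof (induction b rule: basis_vec_induct)
      case (basis vs)
      show ?case
        using r by (auto simp: linear_rels_def left_diff_distrib right_diff_distrib lin_ext_diff
            scaleC_mult_left scaleC_mult_right lin_ext_scale basis_vec_mult word_eval_linear)
    qed (simp_all add: distrib_left lin_ext_add scaleC_mult_right lin_ext_scale)
  qed (simp_all add: distrib_right lin_ext_add scaleC_mult_left lin_ext_scale)
  with step.IH show ?case by (simp add: s lin_ext_add lin_ext_scale)
qed simp

text \<open>\<open>tensor_eval [P1, ..., Pk]\<close> is the linear map sending \<open>y1 \<otimes> ... \<otimes> yk\<close> to
  \<open>y1(P1) ... yk(Pk)\<close>. It is zero on the components of degree other than \<open>k\<close>.\<close>

lift_definition tensor_eval ::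
  "'a::complex_comm_algebra_1 list \<Rightarrow> 'g::complex_lie_algebra tensor_algebra \<Rightarrow> ('g, 'a) tensor uea"
  is "\<lambda>Ps. lin_ext (word_eval Ps)"
  using lin_ext_word_eval_ideal lin_ext_diff by (metis eq_iff_diff_eq_0)

lemma tensor_eval_linear:
  "tensor_eval Ps (s + t) = tensor_eval Ps s + tensor_eval Ps t"
  "tensor_eval Ps (c *\<^sub>C t) = c *\<^sub>C tensor_eval Ps t"
  by (transfer, rule lin_ext_add lin_ext_scale)+

lemma tensor_eval_pure:
  "length ys = length Ps \<Longrightarrow>
     tensor_eval Ps (pure_tensor ys) = prod_list (map2 (\<lambda>y P. uea_inj (y \<otimes> P)) ys Ps)"
  by (simp add: pure_tensor_abs tensor_eval.abs_eq word_eval_def)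

end

theory Submission
  imports Defs
begin

text \<open>By the Leibniz rule, commuting with \<open>x(1)\<close> acts on a product \<open>y1(P1) ... yk(Pk)\<close> by replacing
  each factor \<open>yi(Pi)\<close> in turn by \<open>[x(1), yi(Pi)] = [x, yi](Pi)\<close>. Hence evaluation at
  \<open>P1, ..., Pk\<close> intertwines the adjoint action of \<open>x\<close> with the commutator by \<open>x(1)\<close>,
  and so it sends invariants to elements commuting with \<open>x(1)\<close>.\<close>

lemma commutator_mult_right: "commutator u (v * w) = commutator u v * w + v * commutator u w"
  by (simp add: commutator_def algebra_simps)

lemma commutator_add_right: "commutator u (v + w) = commutator u v + commutator u w"
  by (simp add: commutator_def algebra_simps)

lemma commutator_scaleC_right:
  "commutator u (c *\<^sub>C v) = c *\<^sub>C commutator u (v :: 'u::complex_algebra_1)"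
  by (simp add: commutator_def scaleC_mult_left scaleC_mult_right
      complex_vector.scale_right_diff_distrib)

lemma commutator_uea_inj_pure:
  "commutator (uea_inj (x \<otimes> P)) (uea_inj (y \<otimes> Q)) = uea_inj (lie x y \<otimes> (P * Q))"
  by (simp add: lie_tensor_pure flip: uea_inj_lie)

text \<open>Every word in the product is nonempty, so its length differs from that of
  \<open>[]\<close> and \<open>word_eval\<close> takes its default value 0.\<close>

lemma lin_ext_word_eval_Nil_basis_mult: "lin_ext (word_eval []) (basis_vec [y] * p) = 0"
  by (induction p rule: basis_vec_induct)
    (simp_all add: basis_vec_mult word_eval_def distrib_left lin_ext_add scaleC_mult_right
      lin_ext_scale)

text \<open>Peels off the first factor; on words of the wrong length both sides are 0.\<close>

lemma lin_ext_word_eval_Cons_basis_mult: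
  "lin_ext (word_eval (P # Ps)) (basis_vec [y] * p)
    = uea_inj (y \<otimes> P) * lin_ext (word_eval Ps) p"
  by (induction p rule: basis_vec_induct)
    (simp_all add: basis_vec_mult word_eval_def distrib_left lin_ext_add scaleC_mult_right
      lin_ext_scale)

text \<open>\<open>Ps\<close> varies in the induction because dropping the first letter also drops
  the first parameter.\<close>

lemma lin_ext_word_eval_word_action:
  fixes Ps :: "'a::complex_comm_algebra_1 list"
  shows "lin_ext (word_eval Ps) (word_action x ys)
    = commutator (uea_inj (x \<otimes> (1 :: 'a))) (word_eval Ps ys)"
proof (induction ys arbitrary: Ps)
  case Nil
  \<comment> \<open>The empty word evaluates to 1 or, on a length mismatch, to 0; both are
    central.\<close>
  then show ?case by (simp add: word_eval_def commutator_def)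
next
  case (Cons y ys)
  show ?case
  proof (cases Ps)
    case Nil
    then show ?thesis
      by (simp add: word_action_Cons lin_ext_add lin_ext_word_eval_Nil_basis_mult)
        (simp add: word_eval_def commutator_def)
  next
    case (Cons P Ps')
    have "word_eval (P # Ps') (y # ys) = uea_inj (y \<otimes> P) * word_eval Ps' ys"
      by (simp add: word_eval_def)
    then show ?thesis
      by (simp add: Cons word_action_Cons lin_ext_add lin_ext_word_eval_Cons_basis_mult
          commutator_mult_right commutator_uea_inj_pure Cons.IH)
  qed
qed

text \<open>Both sides are linear in \<open>t\<close>, so representatives that are single words
  suffice.\<close>

lemma tensor_eval_adjoint_action:
  fixes Ps :: "'a::complex_comm_algebra_1 list"
  shows "tensor_eval Ps (adjoint_action x t)
    = commutator (uea_inj (x \<otimes> (1 :: 'a))) (tensor_eval Ps t)"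
proof (induction t rule: tensor_algebra.abs_induct)
  case (1 p)
  show ?case
    by (induction p rule: basis_vec_induct)
      (simp_all add: adjoint_action.abs_eq tensor_eval.abs_eq lin_ext_word_eval_word_action
        lin_ext_add lin_ext_scale commutator_add_right commutator_scaleC_right)
qed

theorem lemma3:
  fixes \<theta> :: "'g::complex_lie_algebra tensor_algebra"
    and Ps :: "'a::complex_comm_algebra_1 list"
    and k :: nat
  assumes "finite_dimensional TYPE('g)"
    and "reductive TYPE('g)"
    and "\<theta> \<in> invariants k"
    and "length Ps = k"
  shows "\<forall>x :: 'g. commutator (uea_inj (x \<otimes> (1 :: 'a))) (tensor_eval Ps \<theta>) = 0"
proof
  fix x :: 'g
  have "adjoint_action x \<theta> = 0"
    using assms(3) by (simp add: invariants_def)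
  moreover have "tensor_eval Ps (0 :: 'g tensor_algebra) = 0"
    using tensor_eval_linear(2)[of Ps 0 0] by simp
  ultimately show "commutator (uea_inj (x \<otimes> (1 :: 'a))) (tensor_eval Ps \<theta>) = 0"
    by (simp flip: tensor_eval_adjoint_action)
qed

end
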